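(* Let $X,Y$ be real Banach spaces with $X\neq\{0\}$ and $Y\neq\{0\}$. (a) The space $X\oplus_1 Y$ is decomposably octahedral (DOH) if and only if $X$ is DOH or $Y$ is DOH. (b) If $N$ is an absolute normalised norm on $\mathbb{R}^2$ different from the $\ell_1$ norm, then the space $X\oplus_N Y$ is not DOH.
   Context: All Banach spaces are real and nontrivial ($\neq\{0\}$). For a Banach space $X$, $S_X$ denotes its unit sphere. A norm $N$ on $\mathbb{R}^2$ is absolute if $N(a,b)=N(|a|,|b|)$ for all $(a,b)\in\mathbb{R}^2$, and normalised if $N(1,0)=N(0,1)=1$. For an absolute normalised norm $N$ on $\mathbb{R}^2$ and Banach spaces $X,Y$, $X\oplus_N Y$ denotes the product space $X\times Y$ equipped with the norm $\|(x,y)\|=N(\|x\|,\|y\|)$. If $N$ is the $\ell_1$ norm on $\mathbb{R}^2$, i.e. $N(a,b)=|a|+|b|$, one writes $X\oplus_1 Y$. A Banach space $X$ is decomposably octahedral (DOH) if, for every finite subset $E$ of $S_X$ and every $\varepsilon>0$, there exists $y\in S_X$ such that, for every $n\in\mathbb{N}$, all $y_1,\ldots,y_n\in X$ with $\sum_{i=1}^n y_i=y$, all $x_1,\ldots,x_n\in E$ (not necessarily distinct), and all real $a_1,b_1,\ldots,a_n,b_n\geq 0$, $$\sum_{i=1}^n\bigl(\|a_ix_i+y_i\|+\|b_ix_i-y_i\|\bigr)\geq(1-\varepsilon)\Bigl(\sum_{i=1}^n(a_i+b_i)+2\Bigr).$$ *)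

theory Defs
  imports "HOL-Analysis.Analysis"
begin

text \<open>
  The norm of \<open>X \<oplus>\<^sub>N Y\<close> depends on the parameter \<open>N\<close>, whereas the library equips the product
  type with the Euclidean norm once and for all. Norms are therefore passed as explicit
  functions on a real vector space; a Banach space \<open>X\<close> is a type of class \<^class>\<open>banach\<close> together
  with its own \<^const>\<open>norm\<close>.
\<close>

definition is_norm :: "('v::real_vector \<Rightarrow> real) \<Rightarrow> bool" where
  "is_norm p \<longleftrightarrow>
     (\<forall>x. p x = 0 \<longleftrightarrow> x = 0) \<and>
     (\<forall>x y. p (x + y) \<le> p x + p y) \<and>
     (\<forall>c x. p (c *\<^sub>R x) = \<bar>c\<bar> * p x)"

definition absolute_norm :: "(real \<times> real \<Rightarrow> real) \<Rightarrow> bool" where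
  "absolute_norm N \<longleftrightarrow> is_norm N \<and> (\<forall>a b. N (a, b) = N (\<bar>a\<bar>, \<bar>b\<bar>))"

definition normalised :: "(real \<times> real \<Rightarrow> real) \<Rightarrow> bool" where
  "normalised N \<longleftrightarrow> N (1, 0) = 1 \<and> N (0, 1) = 1"

definition l1_norm :: "real \<times> real \<Rightarrow> real" where
  "l1_norm = (\<lambda>(a, b). \<bar>a\<bar> + \<bar>b\<bar>)"

definition direct_sum_norm ::
    "(real \<times> real \<Rightarrow> real) \<Rightarrow> 'a::real_normed_vector \<times> 'b::real_normed_vector \<Rightarrow> real" where
  "direct_sum_norm N = (\<lambda>(x, y). N (norm x, norm y))"

definition decomposably_octahedral :: "('v::real_vector \<Rightarrow> real) \<Rightarrow> bool" where
  "decomposably_octahedral p \<longleftrightarrow>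
     (\<forall>E \<epsilon>. finite E \<and> E \<subseteq> {x. p x = 1} \<and> \<epsilon> > 0 \<longrightarrow>
       (\<exists>y. p y = 1 \<and>
         (\<forall>(n::nat) (ys::nat \<Rightarrow> 'v) (xs::nat \<Rightarrow> 'v) (a::nat \<Rightarrow> real) (b::nat \<Rightarrow> real).
            (\<Sum>i=1..n. ys i) = y \<and> (\<forall>i\<in>{1..n}. xs i \<in> E \<and> a i \<ge> 0 \<and> b i \<ge> 0) \<longrightarrow>
            (\<Sum>i=1..n. p (a i *\<^sub>R xs i + ys i) + p (b i *\<^sub>R xs i - ys i))
              \<ge> (1 - \<epsilon>) * ((\<Sum>i=1..n. a i + b i) + 2))))"

lemma absolute_norm_mono:
  assumes N: "absolute_norm N" and "0 \<le> a" "a \<le> a'" "0 \<le> b" "b \<le> b'"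
  shows "N (a, b) \<le> N (a', b')"
proof -
  have tri: "N (u + v) \<le> N u + N v" and hom: "N (c *\<^sub>R u) = \<bar>c\<bar> * N u"
    and ab: "N (s, t) = N (\<bar>s\<bar>, \<bar>t\<bar>)" for u v c s t
    using N unfolding absolute_norm_def is_norm_def by blast+
  have convex: "N (t *\<^sub>R u + (1 - t) *\<^sub>R v) \<le> r"
    if "N u \<le> r" "N v \<le> r" "0 \<le> t" "t \<le> 1" for t u v r
  proof -
    have "N (t *\<^sub>R u + (1 - t) *\<^sub>R v) \<le> t * N u + (1 - t) * N v"
      using tri[of "t *\<^sub>R u" "(1 - t) *\<^sub>R v"] hom that by simp
    also have "\<dots> \<le> t * r + (1 - t) * r"
      using that by (intro add_mono mult_left_mono) auto
    finally show ?thesis by (simp add: algebra_simps)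
  qed
  have ex: "\<exists>t. 0 \<le> t \<and> t \<le> 1 \<and> s = t * s' + (1 - t) * (- s')" if "0 \<le> s" "s \<le> s'" for s s' :: real
  proof (cases "s' = 0")
    case True
    with that show ?thesis by (intro exI[of _ 0]) auto
  next
    case False
    with that show ?thesis
      by (intro exI[of _ "(1 + s / s') / 2"]) (auto simp: field_simps)
  qed
  obtain t where t: "0 \<le> t" "t \<le> 1" "a = t * a' + (1 - t) * (- a')"
    using ex assms by blast
  obtain s where s: "0 \<le> s" "s \<le> 1" "b = s * b' + (1 - s) * (- b')"
    using ex assms by blast
  have ta: "t *\<^sub>R (a', b) + (1 - t) *\<^sub>R (- a', b) = (a, b)"
    unfolding t(3) by (simp add: algebra_simps)
  have sb: "s *\<^sub>R (a', b') + (1 - s) *\<^sub>R (a', - b') = (a', b)"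
    unfolding s(3) by (simp add: algebra_simps)
  have "N (a, b) \<le> N (a', b)"
    using convex[of "(a', b)" "N (a', b)" "(- a', b)" t] ab[of "- a'" b] ab[of a' b] t(1,2)
    unfolding ta by simp
  also have "\<dots> \<le> N (a', b')"
    using convex[of "(a', b')" "N (a', b')" "(a', - b')" s] ab[of a' "- b'"] ab[of a' b'] s(1,2)
    unfolding sb by simp
  finally show ?thesis .
qed

lemma is_norm_direct_sum_norm:
  assumes N: "absolute_norm N"
  shows "is_norm (direct_sum_norm N :: 'a::real_normed_vector \<times> 'b::real_normed_vector \<Rightarrow> real)"
proof -
  have tri: "N (u + v) \<le> N u + N v" and hom: "N (c *\<^sub>R u) = \<bar>c\<bar> * N u"
    and zero: "N u = 0 \<longleftrightarrow> u = 0" for u v c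
    using N unfolding absolute_norm_def is_norm_def by blast+
  have "N (norm (x + x'), norm (y + y')) \<le> N (norm x, norm y) + N (norm x', norm y')"
    for x x' :: 'a and y y' :: 'b
    using absolute_norm_mono[OF N _ norm_triangle_ineq[of x x'] _ norm_triangle_ineq[of y y']]
      tri[of "(norm x, norm y)" "(norm x', norm y')"] by simp
  moreover have "N (norm (c *\<^sub>R x), norm (c *\<^sub>R y)) = \<bar>c\<bar> * N (norm x, norm y)"
    for c and x :: 'a and y :: 'b
    using hom[of "\<bar>c\<bar>" "(norm x, norm y)"] by simp
  ultimately show ?thesis
    by (auto simp: is_norm_def direct_sum_norm_def zero zero_prod_def)
qed

end

theory Submission
  imports Defs
begin

text \<open>
  For a finite \<open>E\<close> in the unit sphere and \<open>\<epsilon> > 0\<close>, subtract \<open>(1 - \<epsilon>) * (\<Sum>i. a i + b i)\<close> from both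
  sides of the inequality that defines decomposable octahedrality. What remains on the left, the
  \<^emph>\<open>excess\<close> of a decomposition, is a sum of separate contributions of its summands. Hence
  the pairs \<open>(y, r)\<close> such that \<open>y\<close> has a decomposition of excess \<open>r\<close> form a convex cone, and the
  space is decomposably octahedral iff for all \<open>E\<close> and \<open>\<epsilon>\<close> some unit vector has only decompositions
  of excess at least \<open>2 * (1 - \<epsilon>)\<close>. Both parts of the theorem are computations in this cone.

  Part (a), from a summand to the sum. If \<open>y\<close> is good in \<open>X\<close> then \<open>(y, 0)\<close> is good in
  \<open>X \<oplus>\<^sub>1 Y\<close>: projecting a decomposition of \<open>(y, 0)\<close> to \<open>X\<close> does not increase its excess, because the
  discarded terms satisfy
  \<open>norm (a *\<^sub>R w + z) + norm (b *\<^sub>R w - z) \<ge> (a + b) * norm w\<close> by the triangle inequality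
  (\<open>excess_project_fst\<close>).

  Part (a), from the sum to a summand. If both \<open>X\<close> and \<open>Y\<close> fail, scaling gives, for every nonzero
  \<open>u\<close>, a decomposition of excess below \<open>2 * (1 - \<epsilon>) * norm u\<close>, and likewise for every nonzero \<open>v\<close> in
  \<open>Y\<close> (\<open>not_decomposably_octahedralE\<close>). Joining such decompositions of \<open>(u, 0)\<close> and of
  \<open>(0, v)\<close> gives one of \<open>(u, v)\<close> whose excess is below
  \<open>2 * (1 - \<epsilon>) * (norm u + norm v)\<close>.

  Part (b). If \<open>N\<close> is not the \<open>\<ell>\<^sub>1\<close> norm then \<open>N (1, 1) = 2 - \<delta>\<close> with \<open>\<delta> > 0\<close>. Choose unit vectors
  \<open>x\<close>, \<open>w\<close> and let \<open>E = {(x, 0), (0, w)}\<close>. Split a unit vector as \<open>(u, v) = (u, 0) + (0, v)\<close> and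
  test each piece against the element of \<open>E\<close> in the \<^emph>\<open>other\<close> summand, with coefficients \<open>norm u\<close>
  and \<open>norm v\<close>. Writing \<open>\<sigma> = norm u + norm v\<close>, this costs \<open>2 * (2 - \<delta>) * \<sigma>\<close>, to be compared with
  \<open>2 * (\<sigma> + 1)\<close>; by convexity of \<open>N\<close> the difference is at least \<open>2 * \<delta>\<^sup>2\<close>
  (\<open>absolute_norm_gap\<close>), which leaves room for a small \<open>\<epsilon>\<close>.
\<close>

section \<open>The cone of decompositions and their excesses\<close>

text \<open>
  Building decompositions one summand at a time, instead of as families indexed by \<open>{1..n}\<close>, turns
  every manipulation of them into a rule induction.
\<close>

inductive excess :: "('v::real_vector \<Rightarrow> real) \<Rightarrow> 'v set \<Rightarrow> real \<Rightarrow> 'v \<Rightarrow> real \<Rightarrow> bool"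
  for p E \<epsilon> where
  zero: "excess p E \<epsilon> 0 0"
| step: "excess p E \<epsilon> (v + y) (p (a *\<^sub>R x + v) + p (b *\<^sub>R x - v) - (1 - \<epsilon>) * (a + b) + r)"
    if "x \<in> E" "0 \<le> a" "0 \<le> b" "excess p E \<epsilon> y r"

lemma excess_sum:
  assumes "\<forall>i\<in>{1..n::nat}. xs i \<in> E \<and> a i \<ge> 0 \<and> b i \<ge> 0"
  shows "excess p E \<epsilon> (\<Sum>i=1..n. ys i)
    (\<Sum>i=1..n. p (a i *\<^sub>R xs i + ys i) + p (b i *\<^sub>R xs i - ys i) - (1 - \<epsilon>) * (a i + b i))"
  using assms
proof (induction n)
  case 0
  show ?case by (simp add: excess.zero)
next
  case (Suc n)
  then have "excess p E \<epsilon> (\<Sum>i=1..n. ys i)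
    (\<Sum>i=1..n. p (a i *\<^sub>R xs i + ys i) + p (b i *\<^sub>R xs i - ys i) - (1 - \<epsilon>) * (a i + b i))"
    by simp
  from excess.step[OF _ _ _ this, of "xs (Suc n)" "a (Suc n)" "b (Suc n)" "ys (Suc n)"] Suc.prems
  show ?case by (simp add: add.commute)
qed

lemma excess_imp_sum:
  assumes "excess p E \<epsilon> y r"
  shows "\<exists>(n::nat) ys xs a b. (\<Sum>i=1..n. ys i) = y \<and>
    (\<forall>i\<in>{1..n}. xs i \<in> E \<and> a i \<ge> 0 \<and> b i \<ge> 0) \<and>
    (\<Sum>i=1..n. p (a i *\<^sub>R xs i + ys i) + p (b i *\<^sub>R xs i - ys i) - (1 - \<epsilon>) * (a i + b i)) = r"
  using assms
proof induction
  case zero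
  show ?case by (rule exI[of _ 0]) simp
next
  case (step x a b y r v)
  then obtain n ys xs as bs where IH: "(\<Sum>i=1..n::nat. ys i) = y"
    "\<forall>i\<in>{1..n}. xs i \<in> E \<and> as i \<ge> 0 \<and> bs i \<ge> 0"
    "(\<Sum>i=1..n. p (as i *\<^sub>R xs i + ys i) + p (bs i *\<^sub>R xs i - ys i)
      - (1 - \<epsilon>) * (as i + bs i)) = r"
    by blast
  define ys' xs' as' bs' where defs: "ys' = ys(Suc n := v)" "xs' = xs(Suc n := x)"
    "as' = as(Suc n := a)" "bs' = bs(Suc n := b)"
  have old: "ys' i = ys i \<and> xs' i = xs i \<and> as' i = as i \<and> bs' i = bs i" if "i \<in> {1..n}" for i
    using that by (auto simp: defs)
  have new: "ys' (Suc n) = v" "xs' (Suc n) = x" "as' (Suc n) = a" "bs' (Suc n) = b"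
    by (auto simp: defs)
  have "(\<Sum>i=1..n. ys' i) = y"
    unfolding IH(1)[symmetric] by (rule sum.cong) (simp_all add: old)
  moreover have "(\<Sum>i=1..n. p (as' i *\<^sub>R xs' i + ys' i) + p (bs' i *\<^sub>R xs' i - ys' i)
      - (1 - \<epsilon>) * (as' i + bs' i)) = r"
    unfolding IH(3)[symmetric] by (rule sum.cong) (simp_all add: old)
  moreover have "\<forall>i\<in>{1..Suc n}. xs' i \<in> E \<and> as' i \<ge> 0 \<and> bs' i \<ge> 0"
    using IH(2) step.hyps old new by (metis atLeastAtMost_iff le_Suc_eq)
  ultimately show ?case
    using new
    by (intro exI[of _ "Suc n"] exI[of _ ys'] exI[of _ xs'] exI[of _ as'] exI[of _ bs'])
      (simp add: add.commute)
qed

lemma decomposably_octahedral_iff_excess: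
  "decomposably_octahedral p \<longleftrightarrow>
    (\<forall>E \<epsilon>. finite E \<and> E \<subseteq> {x. p x = 1} \<and> \<epsilon> > 0 \<longrightarrow>
      (\<exists>y. p y = 1 \<and> (\<forall>r. excess p E \<epsilon> y r \<longrightarrow> 2 * (1 - \<epsilon>) \<le> r)))"
proof -
  have "(\<forall>(n::nat) ys xs a b.
            (\<Sum>i=1..n. ys i) = y \<and> (\<forall>i\<in>{1..n}. xs i \<in> E \<and> a i \<ge> 0 \<and> b i \<ge> 0) \<longrightarrow>
            (\<Sum>i=1..n. p (a i *\<^sub>R xs i + ys i) + p (b i *\<^sub>R xs i - ys i))
              \<ge> (1 - \<epsilon>) * ((\<Sum>i=1..n. a i + b i) + 2))
        \<longleftrightarrow> (\<forall>r. excess p E \<epsilon> y r \<longrightarrow> 2 * (1 - \<epsilon>) \<le> r)" (is "?L \<longleftrightarrow> ?R") for y E \<epsilon>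
  proof -
    have split: "(\<Sum>i=1..n. p (a i *\<^sub>R xs i + ys i) + p (b i *\<^sub>R xs i - ys i) - (1 - \<epsilon>) * (a i + b i))
      = (\<Sum>i=1..n. p (a i *\<^sub>R xs i + ys i) + p (b i *\<^sub>R xs i - ys i))
        - (1 - \<epsilon>) * (\<Sum>i=1..n. a i + b i)" for n :: nat and ys xs a b
      by (simp only: sum_subtractf sum_distrib_left)
    show ?thesis
    proof
      assume L: ?L
      show ?R
      proof (intro allI impI)
        fix r assume "excess p E \<epsilon> y r"
        from excess_imp_sum[OF this] obtain n :: nat and ys xs a b where
          d: "(\<Sum>i=1..n. ys i) = y" "\<forall>i\<in>{1..n}. xs i \<in> E \<and> a i \<ge> 0 \<and> b i \<ge> 0"
          and r: "(\<Sum>i=1..n. p (a i *\<^sub>R xs i + ys i) + p (b i *\<^sub>R xs i - ys i)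
            - (1 - \<epsilon>) * (a i + b i)) = r"
          by blast
        show "2 * (1 - \<epsilon>) \<le> r"
          using L[rule_format, OF conjI, OF d(1), of xs a b] d(2) r
          unfolding split by (auto simp: algebra_simps)
      qed
    next
      assume R: ?R
      show ?L
      proof (intro allI impI, elim conjE)
        fix n :: nat and ys xs :: "nat \<Rightarrow> 'a" and a b :: "nat \<Rightarrow> real"
        assume "(\<Sum>i=1..n. ys i) = y" "\<forall>i\<in>{1..n}. xs i \<in> E \<and> a i \<ge> 0 \<and> b i \<ge> 0"
        with excess_sum[of n xs E a b p \<epsilon> ys] R
        show "(\<Sum>i=1..n. p (a i *\<^sub>R xs i + ys i) + p (b i *\<^sub>R xs i - ys i))
              \<ge> (1 - \<epsilon>) * ((\<Sum>i=1..n. a i + b i) + 2)"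
          unfolding split by (auto simp: algebra_simps)
      qed
    qed
  qed
  then show ?thesis
    unfolding decomposably_octahedral_def by (simp only:)
qed

lemma excess_add:
  assumes "excess p E \<epsilon> y r" "excess p E \<epsilon> y' r'"
  shows "excess p E \<epsilon> (y + y') (r + r')"
  using assms
proof (induction rule: excess.induct)
  case zero
  then show ?case by simp
next
  case (step x a b y r v)
  from excess.step[OF step.hyps(1-3) step.IH[OF step.prems], of v]
  show ?case by (simp add: add.assoc)
qed

lemma excess_scale:
  assumes "is_norm p" "0 \<le> c" "excess p E \<epsilon> y r"
  shows "excess p E \<epsilon> (c *\<^sub>R y) (c * r)"
  using assms(3)
proof induction
  case zero
  show ?case by (simp add: excess.zero)
next
  case (step x a b y r v)
  have hom: "p (c *\<^sub>R z) = c * p z" for z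
    using assms(1,2) by (simp add: is_norm_def)
  have "excess p E \<epsilon> (c *\<^sub>R v + c *\<^sub>R y)
    (p ((c * a) *\<^sub>R x + c *\<^sub>R v) + p ((c * b) *\<^sub>R x - c *\<^sub>R v) - (1 - \<epsilon>) * (c * a + c * b) + c * r)"
    using step assms(2) by (intro excess.step) auto
  then show ?case
    using hom[of "a *\<^sub>R x + v"] hom[of "b *\<^sub>R x - v"] by (simp add: algebra_simps)
qed

text \<open>
  The weakening of \<open>E\<close> and \<open>\<epsilon>\<close> serves to bring two failing pairs \<open>(E, \<epsilon>)\<close>, one from each summand, to
  a common pair in the direct sum.
\<close>

lemma excess_isometry:
  assumes "linear T" "\<And>x. q (T x) = p x" "T ` E \<subseteq> E'" "\<epsilon>' \<le> \<epsilon>" "excess p E \<epsilon> y r"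
  shows "\<exists>r'\<le>r. excess q E' \<epsilon>' (T y) r'"
  using assms(5)
proof induction
  case zero
  show ?case using excess.zero linear_0[OF assms(1)] by (metis order_refl)
next
  case (step x a b y r v)
  then obtain r' where r': "r' \<le> r" "excess q E' \<epsilon>' (T y) r'" by blast
  have lin: "a *\<^sub>R T x + T v = T (a *\<^sub>R x + v)" "b *\<^sub>R T x - T v = T (b *\<^sub>R x - v)"
    "T v + T y = T (v + y)"
    using assms(1) by (simp_all add: linear_add linear_diff linear_scale)
  have "(1 - \<epsilon>) * (a + b) \<le> (1 - \<epsilon>') * (a + b)"
    using assms(4) step.hyps by (intro mult_right_mono) auto
  moreover have "excess q E' \<epsilon>' (T (v + y))
    (p (a *\<^sub>R x + v) + p (b *\<^sub>R x - v) - (1 - \<epsilon>') * (a + b) + r')"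
    using excess.step[of "T x" E' a b q \<epsilon>' "T y" r' "T v"] r' step.hyps assms(2,3)
    unfolding lin by auto
  ultimately show ?case using r'(1)
    by (intro exI[of _ "p (a *\<^sub>R x + v) + p (b *\<^sub>R x - v) - (1 - \<epsilon>') * (a + b) + r'"]) auto
qed

lemma decomposably_octahedral_isometry:
  assumes oct: "decomposably_octahedral q"
    and "linear T" "\<And>x. q (T x) = p x" "\<And>y. T (S y) = y"
  shows "decomposably_octahedral p"
  unfolding decomposably_octahedral_iff_excess
proof (intro allI impI, elim conjE)
  fix E \<epsilon> assume E: "finite E" "E \<subseteq> {x. p x = 1}" "(0::real) < \<epsilon>"
  then have "finite (T ` E)" "T ` E \<subseteq> {x. q x = 1}"
    using assms(3) by auto
  with oct E(3) obtain y where y: "q y = 1" "\<And>r. excess q (T ` E) \<epsilon> y r \<Longrightarrow> 2 * (1 - \<epsilon>) \<le> r"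
    unfolding decomposably_octahedral_iff_excess by meson
  have "2 * (1 - \<epsilon>) \<le> r" if "excess p E \<epsilon> (S y) r" for r
    using excess_isometry[OF assms(2,3) order_refl order_refl that] y(2)
    unfolding assms(4) by force
  moreover have "p (S y) = 1"
    using assms(3)[of "S y"] assms(4) y(1) by simp
  ultimately show "\<exists>y. p y = 1 \<and> (\<forall>r. excess p E \<epsilon> y r \<longrightarrow> 2 * (1 - \<epsilon>) \<le> r)" by blast
qed

text \<open>
  Failure on the unit sphere spreads to all nonzero vectors because excesses scale.
\<close>

lemma not_decomposably_octahedralE:
  assumes "is_norm p" "\<not> decomposably_octahedral p"
  obtains E \<epsilon> where "finite E" "E \<subseteq> {x. p x = 1}" "0 < \<epsilon>"
    "\<And>u. u \<noteq> 0 \<Longrightarrow> \<exists>r. excess p E \<epsilon> u r \<and> r < 2 * (1 - \<epsilon>) * p u"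
proof -
  obtain E \<epsilon> where E: "finite E" "E \<subseteq> {x. p x = 1}" "0 < \<epsilon>"
    and fail: "\<And>y. p y = 1 \<Longrightarrow> \<exists>r. excess p E \<epsilon> y r \<and> r < 2 * (1 - \<epsilon>)"
    using assms(2) unfolding decomposably_octahedral_iff_excess by (meson not_le)
  have "\<exists>r. excess p E \<epsilon> u r \<and> r < 2 * (1 - \<epsilon>) * p u" if "u \<noteq> 0" for u
  proof -
    have hom: "p (c *\<^sub>R x) = \<bar>c\<bar> * p x" and tri: "p (x + y) \<le> p x + p y"
      and zero: "p x = 0 \<longleftrightarrow> x = 0" for c x y
      using assms(1) unfolding is_norm_def by blast+
    have "p u \<noteq> 0" using zero that by simp
    moreover have "0 \<le> p u"
      using tri[of u "- 1 *\<^sub>R u"] hom[of "- 1" u] zero[of 0] by simp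
    ultimately have pos: "0 < p u" by simp
    then have "p ((1 / p u) *\<^sub>R u) = 1" by (simp add: hom)
    then obtain r where r: "excess p E \<epsilon> ((1 / p u) *\<^sub>R u) r" "r < 2 * (1 - \<epsilon>)"
      using fail by blast
    have "excess p E \<epsilon> u (p u * r)"
      using excess_scale[OF assms(1) _ r(1), of "p u"] pos by simp
    moreover have "p u * r < 2 * (1 - \<epsilon>) * p u"
      using mult_strict_left_mono[OF r(2) pos] by (simp add: mult.commute)
    ultimately show ?thesis by blast
  qed
  with E that show thesis by blast
qed

lemma is_norm_norm: "is_norm (norm :: 'v::real_normed_vector \<Rightarrow> real)"
  by (simp add: is_norm_def norm_triangle_ineq)

lemma exists_unit_vector:
  assumes "(UNIV :: 'v::real_normed_vector set) \<noteq> {0}"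
  shows "\<exists>x :: 'v. norm x = 1"
proof -
  obtain z :: 'v where "z \<noteq> 0" using assms by blast
  then have "norm (sgn z) = 1" by (simp add: norm_sgn)
  then show ?thesis by blast
qed

section \<open>The \<open>\<ell>\<^sub>1\<close> sum\<close>

lemma direct_sum_norm_l1 [simp]: "direct_sum_norm l1_norm (x, y) = norm x + norm y"
  by (simp add: direct_sum_norm_def l1_norm_def)

text \<open>
  The first component \<open>f\<close> of an element of \<open>E\<close> need not be a unit vector: it is written as
  \<open>norm f *\<^sub>R h f\<close>, and the factor \<open>norm f\<close> goes into the coefficients \<open>a\<close> and \<open>b\<close>. The remaining
  part \<open>norm g\<close> of \<open>norm f + norm g = 1\<close> pays for the discarded second components.
\<close>

lemma excess_project_fst:
  fixes E :: "('a::real_normed_vector \<times> 'b::real_normed_vector) set"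
  assumes "E \<subseteq> {z. direct_sum_norm l1_norm z = 1}" "0 \<le> \<epsilon>" "\<And>f. norm f *\<^sub>R h f = f"
    and "excess (direct_sum_norm l1_norm) E \<epsilon> y r"
  shows "\<exists>r'\<le>r. excess norm (h ` fst ` E) \<epsilon> (fst y) r'"
  using assms(4)
proof induction
  case zero
  show ?case by (intro exI[of _ 0]) (simp add: excess.zero)
next
  case (step x a b y r v)
  then obtain r' where r': "r' \<le> r" "excess norm (h ` fst ` E) \<epsilon> (fst y) r'" by blast
  obtain f g where x: "x = (f, g)" by fastforce
  obtain v1 v2 where v: "v = (v1, v2)" by fastforce
  have fg: "norm f + norm g = 1" using step.hyps(1) assms(1) x by auto
  define s where "s = norm (a *\<^sub>R f + v1) + norm (b *\<^sub>R f - v1)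
    - (1 - \<epsilon>) * (a * norm f + b * norm f) + r'"
  have "h f \<in> h ` fst ` E" using step.hyps(1) x by force
  then have "excess norm (h ` fst ` E) \<epsilon> (v1 + fst y)
    (norm ((a * norm f) *\<^sub>R h f + v1) + norm ((b * norm f) *\<^sub>R h f - v1)
      - (1 - \<epsilon>) * (a * norm f + b * norm f) + r')"
    using r'(2) step.hyps by (intro excess.step) auto
  then have "excess norm (h ` fst ` E) \<epsilon> (fst (v + y)) s"
    using assms(3)[of f] by (simp add: s_def v flip: scaleR_scaleR)
  moreover have "s \<le> direct_sum_norm l1_norm (a *\<^sub>R x + v) + direct_sum_norm l1_norm (b *\<^sub>R x - v)
    - (1 - \<epsilon>) * (a + b) + r"
  proof -
    have "0 \<le> \<epsilon> * ((a + b) * norm g)"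
      using assms(2) step.hyps by simp
    then have "(1 - \<epsilon>) * ((a + b) * norm g) \<le> (a + b) * norm g"
      by (simp only: left_diff_distrib mult_1)
    also have "\<dots> = norm ((a *\<^sub>R g + v2) + (b *\<^sub>R g - v2))"
      using step.hyps by (simp flip: scaleR_add_left)
    also have "\<dots> \<le> norm (a *\<^sub>R g + v2) + norm (b *\<^sub>R g - v2)" by (rule norm_triangle_ineq)
    finally have g: "(1 - \<epsilon>) * ((a + b) * norm g) \<le> norm (a *\<^sub>R g + v2) + norm (b *\<^sub>R g - v2)" .
    have "(1 - \<epsilon>) * (a + b)
      = (1 - \<epsilon>) * (a * norm f + b * norm f) + (1 - \<epsilon>) * ((a + b) * norm g)"
    proof -
      have "(1 - \<epsilon>) * (a + b) = (1 - \<epsilon>) * (a + b) * (norm f + norm g)" by (simp add: fg)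
      then show ?thesis by (simp only: algebra_simps)
    qed
    with g r'(1) show ?thesis by (simp add: s_def x v)
  qed
  ultimately show ?case by blast
qed

lemma decomposably_octahedral_l1_sum_fst:
  assumes "(UNIV :: 'a::real_normed_vector set) \<noteq> {0}"
    and oct: "decomposably_octahedral (norm :: 'a \<Rightarrow> real)"
  shows "decomposably_octahedral
    (direct_sum_norm l1_norm :: 'a \<times> 'b::real_normed_vector \<Rightarrow> real)"
  unfolding decomposably_octahedral_iff_excess
proof (intro allI impI, elim conjE)
  fix E :: "('a \<times> 'b) set" and \<epsilon> :: real
  assume E: "finite E" "E \<subseteq> {z. direct_sum_norm l1_norm z = 1}" "0 < \<epsilon>"
  obtain x0 :: 'a where x0: "norm x0 = 1" using exists_unit_vector[OF assms(1)] by blast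
  define h where "h f = (if f = 0 then x0 else sgn f)" for f :: 'a
  have h: "norm f *\<^sub>R h f = f" "norm (h f) = 1" for f
    by (auto simp: h_def x0 norm_sgn sgn_div_norm)
  then have "finite (h ` fst ` E)" "h ` fst ` E \<subseteq> {x. norm x = 1}" using E(1) by auto
  with oct E(3) obtain y where y: "norm y = 1"
    "\<And>r. excess norm (h ` fst ` E) \<epsilon> y r \<Longrightarrow> 2 * (1 - \<epsilon>) \<le> r"
    unfolding decomposably_octahedral_iff_excess by meson
  have "2 * (1 - \<epsilon>) \<le> r" if "excess (direct_sum_norm l1_norm) E \<epsilon> (y, 0) r" for r
    using excess_project_fst[OF E(2) _ h(1) that] E(3) y(2) by force
  moreover have "direct_sum_norm l1_norm (y, 0::'b) = 1" using y(1) by simp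
  ultimately show "\<exists>y. direct_sum_norm l1_norm y = 1 \<and>
      (\<forall>r. excess (direct_sum_norm l1_norm) E \<epsilon> y r \<longrightarrow> 2 * (1 - \<epsilon>) \<le> r)"
    by blast
qed

lemma decomposably_octahedral_l1_sum_swap:
  assumes "decomposably_octahedral
    (direct_sum_norm l1_norm :: 'b::real_normed_vector \<times> 'a::real_normed_vector \<Rightarrow> real)"
  shows "decomposably_octahedral (direct_sum_norm l1_norm :: 'a \<times> 'b \<Rightarrow> real)"
proof (rule decomposably_octahedral_isometry[OF assms])
  show "linear (prod.swap :: 'a \<times> 'b \<Rightarrow> 'b \<times> 'a)"
    by (rule linearI) (auto simp: prod.swap_def)
  show "direct_sum_norm l1_norm (prod.swap z) = direct_sum_norm l1_norm z" for z :: "'a \<times> 'b"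
    by (cases z) simp
  show "prod.swap (prod.swap z) = z" for z :: "'b \<times> 'a" by simp
qed

lemma decomposably_octahedral_l1_sumD:
  assumes "decomposably_octahedral
    (direct_sum_norm l1_norm :: 'a::real_normed_vector \<times> 'b::real_normed_vector \<Rightarrow> real)"
  shows "decomposably_octahedral (norm :: 'a \<Rightarrow> real) \<or>
    decomposably_octahedral (norm :: 'b \<Rightarrow> real)"
proof (rule ccontr)
  assume "\<not> ?thesis"
  then have no: "\<not> decomposably_octahedral (norm :: 'a \<Rightarrow> real)"
    "\<not> decomposably_octahedral (norm :: 'b \<Rightarrow> real)" by auto
  obtain E1 :: "'a set" and \<epsilon>1 where E1: "finite E1" "E1 \<subseteq> {x. norm x = 1}" "0 < \<epsilon>1"
    and fail1: "\<And>u. u \<noteq> 0 \<Longrightarrow> \<exists>r. excess norm E1 \<epsilon>1 u r \<and> r < 2 * (1 - \<epsilon>1) * norm u"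
    using not_decomposably_octahedralE[OF is_norm_norm no(1)] by blast
  obtain E2 :: "'b set" and \<epsilon>2 where E2: "finite E2" "E2 \<subseteq> {x. norm x = 1}" "0 < \<epsilon>2"
    and fail2: "\<And>u. u \<noteq> 0 \<Longrightarrow> \<exists>r. excess norm E2 \<epsilon>2 u r \<and> r < 2 * (1 - \<epsilon>2) * norm u"
    using not_decomposably_octahedralE[OF is_norm_norm no(2)] by blast
  define E where "E = (\<lambda>x. (x, 0::'b)) ` E1 \<union> (\<lambda>y. (0::'a, y)) ` E2"
  define \<epsilon> where "\<epsilon> = min \<epsilon>1 \<epsilon>2"
  have "finite E" "E \<subseteq> {z. direct_sum_norm l1_norm z = 1}" "0 < \<epsilon>"
    using E1 E2 by (auto simp: E_def \<epsilon>_def)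
  with assms obtain z where z: "direct_sum_norm l1_norm z = 1"
    "\<And>r. excess (direct_sum_norm l1_norm) E \<epsilon> z r \<Longrightarrow> 2 * (1 - \<epsilon>) \<le> r"
    unfolding decomposably_octahedral_iff_excess by meson
  obtain u v where uv: "z = (u, v)" by fastforce
  have lin: "linear (\<lambda>x::'a. (x, 0::'b))" "linear (\<lambda>y::'b. (0::'a, y))"
    by (auto intro!: linearI)
  have left: "\<exists>r. excess (direct_sum_norm l1_norm) E \<epsilon> (u, 0) r \<and> r < 2 * (1 - \<epsilon>) * norm u"
    if nz: "u \<noteq> 0"
  proof -
    obtain r where r: "excess norm E1 \<epsilon>1 u r" "r < 2 * (1 - \<epsilon>1) * norm u"
      using fail1[OF nz] by blast
    have "\<exists>r'\<le>r. excess (direct_sum_norm l1_norm) E \<epsilon> (u, 0) r'"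
      using r(1) by (intro excess_isometry[OF lin(1)]) (auto simp: E_def \<epsilon>_def)
    moreover have "2 * (1 - \<epsilon>1) * norm u \<le> 2 * (1 - \<epsilon>) * norm u"
      by (intro mult_right_mono) (auto simp: \<epsilon>_def)
    ultimately show ?thesis using r(2) by force
  qed
  have right: "\<exists>r. excess (direct_sum_norm l1_norm) E \<epsilon> (0, v) r \<and> r < 2 * (1 - \<epsilon>) * norm v"
    if nz: "v \<noteq> 0"
  proof -
    obtain r where r: "excess norm E2 \<epsilon>2 v r" "r < 2 * (1 - \<epsilon>2) * norm v"
      using fail2[OF nz] by blast
    have "\<exists>r'\<le>r. excess (direct_sum_norm l1_norm) E \<epsilon> (0, v) r'"
      using r(1) by (intro excess_isometry[OF lin(2)]) (auto simp: E_def \<epsilon>_def)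
    moreover have "2 * (1 - \<epsilon>2) * norm v \<le> 2 * (1 - \<epsilon>) * norm v"
      by (intro mult_right_mono) (auto simp: \<epsilon>_def)
    ultimately show ?thesis using r(2) by force
  qed
  have sum1: "norm u + norm v = 1" using z(1) uv by simp
  have "\<exists>r. excess (direct_sum_norm l1_norm) E \<epsilon> (u, v) r \<and> r < 2 * (1 - \<epsilon>)"
  proof (cases "u = 0 \<or> v = 0")
    case True
    then show ?thesis using left right sum1 by (cases "u = 0"; cases "v = 0") auto
  next
    case False
    then obtain r r' where
      r: "excess (direct_sum_norm l1_norm) E \<epsilon> (u, 0) r" "r < 2 * (1 - \<epsilon>) * norm u" and
      r': "excess (direct_sum_norm l1_norm) E \<epsilon> (0, v) r'" "r' < 2 * (1 - \<epsilon>) * norm v"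
      using left right by blast
    have "r + r' < 2 * (1 - \<epsilon>) * (norm u + norm v)"
      using r(2) r'(2) by (simp add: distrib_left)
    with excess_add[OF r(1) r'(1)] sum1 show ?thesis by auto
  qed
  with z(2) uv show False by force
qed

section \<open>Other absolute sums\<close>

text \<open>
  Convexity: for \<open>t \<le> s\<close> this is \<open>N (s, s) \<le> N (s, t) + N (0, s - t)\<close>.
\<close>

lemma absolute_norm_lower_bound:
  assumes "absolute_norm N" "normalised N" "0 \<le> s" "0 \<le> t"
  shows "N (1, 1) * max s t - \<bar>s - t\<bar> \<le> N (s, t)"
proof -
  have tri: "N (u + v) \<le> N u + N v" and hom: "N (c *\<^sub>R u) = \<bar>c\<bar> * N u" for u v c
    using assms(1) unfolding absolute_norm_def is_norm_def by blast+
  have diag: "N (max s t, max s t) = max s t * N (1, 1)"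
    using hom[of "max s t" "(1, 1)"] assms(3,4) by simp
  have axes: "N (c, 0) = \<bar>c\<bar>" "N (0, c) = \<bar>c\<bar>" for c
    using hom[of c "(1, 0)"] hom[of c "(0, 1)"] assms(2) by (auto simp: normalised_def)
  show ?thesis
  proof (cases "t \<le> s")
    case True
    then show ?thesis using tri[of "(s, t)" "(0, s - t)"] diag axes(2)[of "s - t"]
      by (simp add: max_def mult.commute split: if_splits)
  next
    case False
    then show ?thesis using tri[of "(s, t)" "(t - s, 0)"] diag axes(1)[of "t - s"]
      by (simp add: max_def mult.commute)
  qed
qed

lemma absolute_norm_ge_component:
  assumes "absolute_norm N" "normalised N" "0 \<le> s" "0 \<le> t"
  shows "s \<le> N (s, t)" "t \<le> N (s, t)"
proof -
  have hom: "N (c *\<^sub>R u) = \<bar>c\<bar> * N u" for u c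
    using assms(1) unfolding absolute_norm_def is_norm_def by blast
  have "N (s, 0) = s" "N (0, t) = t"
    using hom[of s "(1, 0)"] hom[of t "(0, 1)"] assms by (auto simp: normalised_def)
  then show "s \<le> N (s, t)" "t \<le> N (s, t)"
    using absolute_norm_mono[OF assms(1), of s s 0 t] absolute_norm_mono[OF assms(1), of 0 s t t] assms
    by auto
qed

lemma absolute_norm_diagonal_less_2:
  assumes "absolute_norm N" "normalised N" "N \<noteq> l1_norm"
  shows "N (1, 1) < 2"
proof (rule ccontr)
  assume "\<not> ?thesis"
  then have ge: "2 \<le> N (1, 1)" by simp
  have tri: "N (u + v) \<le> N u + N v" and hom: "N (c *\<^sub>R u) = \<bar>c\<bar> * N u"
    and ab: "N (s, t) = N (\<bar>s\<bar>, \<bar>t\<bar>)" for u v c s t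
    using assms(1) unfolding absolute_norm_def is_norm_def by blast+
  have "N (s, t) = \<bar>s\<bar> + \<bar>t\<bar>" for s t
  proof (rule antisym)
    show "N (s, t) \<le> \<bar>s\<bar> + \<bar>t\<bar>"
      using tri[of "(s, 0)" "(0, t)"] hom[of s "(1, 0)"] hom[of t "(0, 1)"] assms(2)
      by (simp add: normalised_def)
    have "2 * max \<bar>s\<bar> \<bar>t\<bar> \<le> N (1, 1) * max \<bar>s\<bar> \<bar>t\<bar>"
      using ge by (intro mult_right_mono) auto
    moreover have "\<bar>s\<bar> + \<bar>t\<bar> = 2 * max \<bar>s\<bar> \<bar>t\<bar> - \<bar>\<bar>s\<bar> - \<bar>t\<bar>\<bar>"
      by (simp add: max_def)
    ultimately show "\<bar>s\<bar> + \<bar>t\<bar> \<le> N (s, t)"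
      using absolute_norm_lower_bound[OF assms(1,2), of "\<bar>s\<bar>" "\<bar>t\<bar>"] ab[of s t] by linarith
  qed
  then have "N = l1_norm" by (auto simp: l1_norm_def fun_eq_iff)
  with assms(3) show False by simp
qed

text \<open>
  With \<open>\<delta> = 2 - N (1, 1)\<close> and \<open>m = min s t\<close>, the lower bound on \<open>N (s, t)\<close> gives
  \<open>1 - (1 - \<delta>) * (s + t) \<ge> \<delta> * m\<close>, which is useful for large \<open>m\<close>, while \<open>s + t \<le> 1 + m\<close> gives
  \<open>1 - (1 - \<delta>) * (s + t) \<ge> \<delta> - (1 - \<delta>) * m\<close>, which is useful for small \<open>m\<close>. In the convex combination
  with weights \<open>1 - \<delta>\<close> and \<open>\<delta>\<close> the terms in \<open>m\<close> cancel.
\<close>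

lemma absolute_norm_gap:
  assumes "absolute_norm N" "normalised N" "0 \<le> s" "0 \<le> t" "N (s, t) = 1"
  shows "N (1, 1) * (s + t) + (2 - N (1, 1))\<^sup>2 \<le> s + t + 1"
proof -
  define \<delta> m where "\<delta> = 2 - N (1, 1)" and "m = min s t"
  have \<delta>: "0 \<le> \<delta>" "\<delta> \<le> 1"
  proof -
    have tri: "N (u + v) \<le> N u + N v" for u v
      using assms(1) unfolding absolute_norm_def is_norm_def by blast
    show "0 \<le> \<delta>" using tri[of "(1, 0)" "(0, 1)"] assms(2) by (simp add: \<delta>_def normalised_def)
    show "\<delta> \<le> 1" using absolute_norm_ge_component(1)[OF assms(1,2), of 1 1] by (simp add: \<delta>_def)
  qed
  have M: "max s t = s + t - m" "\<bar>s - t\<bar> = s + t - 2 * m" by (auto simp: m_def)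
  have "(2 - \<delta>) * (s + t - m) - (s + t - 2 * m) \<le> 1"
    using absolute_norm_lower_bound[OF assms(1-4)] assms(5) unfolding M by (simp add: \<delta>_def)
  then have large: "\<delta> * m \<le> 1 - (1 - \<delta>) * (s + t)" by (simp add: algebra_simps)
  have "s + t \<le> 1 + m"
    using absolute_norm_ge_component[OF assms(1-4)] assms(5) by (auto simp: m_def)
  then have "(1 - \<delta>) * (s + t) \<le> (1 - \<delta>) * (1 + m)"
    using \<delta> by (intro mult_left_mono) auto
  then have small: "\<delta> - (1 - \<delta>) * m \<le> 1 - (1 - \<delta>) * (s + t)" by (simp add: algebra_simps)
  define g where "g = 1 - (1 - \<delta>) * (s + t)"
  have "(1 - \<delta>) * (\<delta> * m) + \<delta> * (\<delta> - (1 - \<delta>) * m) \<le> (1 - \<delta>) * g + \<delta> * g"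
    using large small \<delta> by (intro add_mono mult_left_mono) (auto simp: g_def)
  then have "\<delta>\<^sup>2 \<le> g" by (simp add: algebra_simps power2_eq_square)
  moreover have "s + t + 1 - N (1, 1) * (s + t) = g"
    by (simp add: g_def \<delta>_def algebra_simps)
  ultimately show ?thesis by (simp add: \<delta>_def)
qed

lemma not_decomposably_octahedral_absolute_sum:
  assumes "(UNIV :: 'a::real_normed_vector set) \<noteq> {0}"
    and "(UNIV :: 'b::real_normed_vector set) \<noteq> {0}"
    and N: "absolute_norm N" "normalised N" "N \<noteq> l1_norm"
  shows "\<not> decomposably_octahedral (direct_sum_norm N :: 'a \<times> 'b \<Rightarrow> real)"
proof
  assume oct: "decomposably_octahedral (direct_sum_norm N :: 'a \<times> 'b \<Rightarrow> real)"
  obtain x :: 'a where x: "norm x = 1" using exists_unit_vector[OF assms(1)] by blast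
  obtain w :: 'b where w: "norm w = 1" using exists_unit_vector[OF assms(2)] by blast
  define \<delta> E where "\<delta> = 2 - N (1, 1)" and "E = {(x, 0), (0, w)}"
  have "0 < \<delta>" using absolute_norm_diagonal_less_2[OF N] by (simp add: \<delta>_def)
  \<comment> \<open>The factor \<open>4\<close> beats \<open>norm u + norm v + 1 \<le> 3\<close>.\<close>
  define \<epsilon> where "\<epsilon> = \<delta>\<^sup>2 / 4"
  have \<epsilon>: "0 < \<epsilon>" using \<open>0 < \<delta>\<close> by (simp add: \<epsilon>_def)
  have "finite E" "E \<subseteq> {z. direct_sum_norm N z = 1}"
    using N(2) x w by (auto simp: E_def direct_sum_norm_def normalised_def)
  with oct \<epsilon> obtain z where z: "direct_sum_norm N z = 1"
    "\<And>r. excess (direct_sum_norm N) E \<epsilon> z r \<Longrightarrow> 2 * (1 - \<epsilon>) \<le> r"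
    unfolding decomposably_octahedral_iff_excess by meson
  obtain u v where uv: "z = (u, v)" by fastforce
  define s t where "s = norm u" and "t = norm v"
  have st: "0 \<le> s" "0 \<le> t" "N (s, t) = 1"
    using z(1) by (auto simp: s_def t_def uv direct_sum_norm_def)
  have diag: "N (c, c) = c * N (1, 1)" if "0 \<le> c" for c
  proof -
    have "N (c *\<^sub>R (1, 1)) = \<bar>c\<bar> * N (1, 1)"
      using N(1) unfolding absolute_norm_def is_norm_def by blast
    then show ?thesis using that by simp
  qed
  have "excess (direct_sum_norm N) E \<epsilon> ((u, 0) + ((0, v) + 0))
    (direct_sum_norm N (s *\<^sub>R (0, w) + (u, 0)) + direct_sum_norm N (s *\<^sub>R (0, w) - (u, 0))
      - (1 - \<epsilon>) * (s + s)
    + (direct_sum_norm N (t *\<^sub>R (x, 0) + (0, v)) + direct_sum_norm N (t *\<^sub>R (x, 0) - (0, v))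
      - (1 - \<epsilon>) * (t + t) + 0))"
    using st(1,2) by (intro excess.step excess.zero) (auto simp: E_def)
  moreover have "direct_sum_norm N (s *\<^sub>R (0, w) + (u, 0)) = s * N (1, 1)"
    "direct_sum_norm N (s *\<^sub>R (0, w) - (u, 0)) = s * N (1, 1)"
    "direct_sum_norm N (t *\<^sub>R (x, 0) + (0, v)) = t * N (1, 1)"
    "direct_sum_norm N (t *\<^sub>R (x, 0) - (0, v)) = t * N (1, 1)"
    using x w diag[OF st(1)] diag[OF st(2)] by (auto simp: direct_sum_norm_def s_def t_def)
  ultimately have "excess (direct_sum_norm N) E \<epsilon> z
    (2 * (N (1, 1) * (s + t)) - 2 * ((1 - \<epsilon>) * (s + t)))"
    by (simp add: uv algebra_simps)
  from z(2)[OF this] have "s + t + 1 \<le> N (1, 1) * (s + t) + \<epsilon> * (s + t + 1)"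
    by (simp add: algebra_simps)
  moreover have "\<epsilon> * (s + t + 1) \<le> \<epsilon> * 3"
    using absolute_norm_ge_component[OF N(1,2) st(1,2)] st(3) \<epsilon> by (intro mult_left_mono) auto
  moreover have "N (1, 1) * (s + t) + 4 * \<epsilon> \<le> s + t + 1"
    using absolute_norm_gap[OF N(1,2) st] by (simp add: \<epsilon>_def \<delta>_def)
  ultimately show False using \<epsilon> by linarith
qed

theorem proposition3p1:
  assumes "(UNIV :: 'a::banach set) \<noteq> {0}"
    and "(UNIV :: 'b::banach set) \<noteq> {0}"
  shows "(decomposably_octahedral (direct_sum_norm l1_norm :: 'a \<times> 'b \<Rightarrow> real) \<longleftrightarrow>
            decomposably_octahedral (norm :: 'a \<Rightarrow> real) \<or>
            decomposably_octahedral (norm :: 'b \<Rightarrow> real)) \<and>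
         (\<forall>N. absolute_norm N \<and> normalised N \<and> N \<noteq> l1_norm \<longrightarrow>
            \<not> decomposably_octahedral (direct_sum_norm N :: 'a \<times> 'b \<Rightarrow> real))"
  using decomposably_octahedral_l1_sumD
    decomposably_octahedral_l1_sum_fst[OF assms(1), where 'b = 'b]
    decomposably_octahedral_l1_sum_swap[OF decomposably_octahedral_l1_sum_fst[OF assms(2), where 'b = 'a]]
    not_decomposably_octahedral_absolute_sum[OF assms]
  by blast

end
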